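(* Let $\mathbb{T}$ be a time scale, let $\alpha,\beta\in\mathbb{T}$ with $\alpha<\beta$, and let $\psi,\phi:[\alpha,\beta]_{\mathbb{T}}\to\mathbb{R}$ be Delta-integrable functions with $\phi>0$. If $\psi/\phi$ is increasing (respectively, decreasing) on $[\alpha,\beta]_{\mathbb{T}}$, then the function $$s\mapsto \frac{\int_{\alpha}^s \psi(\upsilon)\,\Delta\upsilon}{\int_{\alpha}^s \phi(\upsilon)\,\Delta\upsilon}$$ is increasing (respectively, decreasing) for $s\in[\alpha,\beta]_{\mathbb{T}}$, $s>\alpha$.
   Context: A time scale $\mathbb{T}$ is a nonempty closed subset of $\mathbb{R}$, and $[\alpha,\beta]_{\mathbb{T}}=[\alpha,\beta]\cap\mathbb{T}$. The Delta integral $\int_a^b f(\upsilon)\,\Delta\upsilon$ ($a\le b$ in $\mathbb{T}$) is the standard one, i.e. the integral of $f$ over $[a,b)\cap\mathbb{T}$ with respect to the Delta measure $\mu_\Delta$ on $\mathbb{T}$, determined by $\mu_\Delta([c,d)\cap\mathbb{T})=d-c$ for $c\le d$ in $\mathbb{T}$. "Increasing" and "decreasing" are meant in the non-strict sense. *)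

theory Defs
  imports "HOL-Analysis.Analysis"
begin

definition time_scale :: "real set \<Rightarrow> bool" where
  "time_scale T \<longleftrightarrow> closed T \<and> T \<noteq> {}"

(* The completion makes this the Lebesgue Delta-measure rather than its Borel part, so
   that Riemann Delta-integrable functions are covered too.  If T has a maximum m, the
   condition on the half-open intervals leaves the measure of {m} undetermined; the point
   m lies in no interval [a, b) with b in T, so the integrals below do not depend on it. *)
definition delta_measure :: "real set \<Rightarrow> real measure" where
  "delta_measure T = completion
     (extend_measure T {(c, d). c \<in> T \<and> d \<in> T \<and> c \<le> d}
       (\<lambda>(c, d). {c..<d} \<inter> T) (\<lambda>(c, d). ennreal (d - c)))"

definition delta_integrable :: "real set \<Rightarrow> real \<Rightarrow> real \<Rightarrow> (real \<Rightarrow> real) \<Rightarrow> bool" where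
  "delta_integrable T a b f \<longleftrightarrow> set_integrable (delta_measure T) ({a..<b} \<inter> T) f"

definition delta_integral :: "real set \<Rightarrow> real \<Rightarrow> real \<Rightarrow> (real \<Rightarrow> real) \<Rightarrow> real" where
  "delta_integral T a b f = set_lebesgue_integral (delta_measure T) ({a..<b} \<inter> T) f"

(* extend_measure silently yields the zero measure when no extension exists.  The next
   lemma excludes this; the extension is the image of Lebesgue measure under the map
   that sends x to the largest point of T below x. *)
lemma emeasure_delta_measure:
  assumes T: "time_scale T" and cd: "c \<in> T" "d \<in> T" "c \<le> d"
  shows "{c..<d} \<inter> T \<in> sets (delta_measure T)"
    and "emeasure (delta_measure T) ({c..<d} \<inter> T) = ennreal (d - c)"
proof -
  let ?I = "\<lambda>c d. c \<in> T \<and> d \<in> T \<and> c \<le> d"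
  let ?G = "\<lambda>(c, d). {c..<d} \<inter> T"
  let ?N = "extend_measure T {(c, d). ?I c d} ?G (\<lambda>(c, d). ennreal (d - c))"
  have cl: "closed T" using T by (simp add: time_scale_def)
  have sub: "?G ` {(c, d). ?I c d} \<subseteq> Pow T" by auto
  have space_N: "space ?N = T" by (rule space_extend_measure[OF sub])
  have sets_N: "sets ?N = sigma_sets T (?G ` {(c, d). ?I c d})" by (rule sets_extend_measure[OF sub])
  have G_in: "{c..<d} \<inter> T \<in> sets ?N"
    unfolding sets_N using cd by (intro sigma_sets.Basic) (auto intro!: image_eqI[of _ _ "(c, d)"])
  define D where "D = {x. \<exists>t\<in>T. t \<le> x}"
  define p where "p x = Sup (T \<inter> {..x})" for x
  have p: "p x \<in> T" "p x \<le> x" if "x \<in> D" for x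
  proof -
    have "p x \<in> T \<inter> {..x}" unfolding p_def
      using that cl by (intro closed_contains_Sup) (auto simp: D_def intro: bdd_aboveI[of _ x])
    then show "p x \<in> T" "p x \<le> x" by auto
  qed
  have p_ge: "t \<le> p x" if "t \<in> T" "t \<le> x" for t x
    unfolding p_def using that by (intro cSup_upper) (auto intro: bdd_aboveI[of _ x])
  have vimage: "p -` ({a..<b} \<inter> T) \<inter> D = {a..<b}" if "?I a b" for a b
  proof (intro set_eqI iffI)
    fix x assume "x \<in> p -` ({a..<b} \<inter> T) \<inter> D"
    then show "x \<in> {a..<b}" using p[of x] p_ge[of b x] that by force
  next
    fix x assume x: "x \<in> {a..<b}"
    then have "x \<in> D" using that by (auto simp: D_def)
    with x show "x \<in> p -` ({a..<b} \<inter> T) \<inter> D" using p[of x] p_ge[of a x] that by auto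
  qed
  define R where "R = restrict_space lborel D"
  have D_borel: "D \<in> sets borel"
  proof -
    have "is_interval D" unfolding is_interval_1 D_def by (blast intro: order_trans)
    then show ?thesis by (rule real_interval_borel_measurable)
  qed
  have space_R: "space R = D" by (simp add: R_def space_restrict_space)
  have p_meas: "p \<in> measurable R (measure_of T (?G ` {(c, d). ?I c d}) (\<lambda>_. 0))"
  proof (rule measurable_measure_of[OF sub])
    show "p \<in> space R \<rightarrow> T" using p by (auto simp: space_R)
    fix y assume "y \<in> ?G ` {(c, d). ?I c d}"
    then obtain a b where ab: "?I a b" "y = {a..<b} \<inter> T" by auto
    have "{a..<b} \<subseteq> D" using ab by (auto simp: D_def)
    then have "{a..<b} \<in> sets R"
      using D_borel by (simp add: R_def sets_restrict_space_iff)
    then show "p -` y \<inter> space R \<in> sets R"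
      by (simp only: space_R ab(2) vimage[OF ab(1)])
  qed
  moreover have "sets (measure_of T (?G ` {(c, d). ?I c d}) (\<lambda>_. 0)) = sets ?N"
    unfolding sets_N by (rule sets_measure_of[OF sub])
  ultimately have p_meas: "p \<in> measurable R ?N"
    using measurable_cong_sets[OF refl] by blast
  have "emeasure ?N ({c..<d} \<inter> T) = ennreal (d - c)"
  proof (rule emeasure_extend_measure_Pair[OF refl, where \<mu>' = "emeasure (distr R ?N p)"])
    fix a b assume ab: "?I a b"
    have "{a..<b} \<inter> T \<in> sets ?N"
      unfolding sets_N using ab by (intro sigma_sets.Basic) (auto intro!: image_eqI[of _ _ "(a, b)"])
    moreover have "{a..<b} \<subseteq> D" using ab by (auto simp: D_def)
    then have "emeasure R {a..<b} = ennreal (b - a)"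
      using ab D_borel by (simp add: R_def emeasure_restrict_space)
    ultimately show "emeasure (distr R ?N p) ({a..<b} \<inter> T) = ennreal (b - a)"
      by (simp only: emeasure_distr[OF p_meas] space_R vimage[OF ab])
  next
    show "positive (sets ?N) (emeasure (distr R ?N p))"
      using emeasure_positive[of "distr R ?N p"] by simp
    show "countably_additive (sets ?N) (emeasure (distr R ?N p))"
      using emeasure_countably_additive[of "distr R ?N p"] by simp
  qed (use cd in auto)
  then show "{c..<d} \<inter> T \<in> sets (delta_measure T)"
    and "emeasure (delta_measure T) ({c..<d} \<inter> T) = ennreal (d - c)"
    using G_in by (simp_all add: delta_measure_def)
qed

end

theory Submission
  imports Defs
begin

text \<open>
  Fix \<open>r \<le> s\<close> and put \<open>c = \<psi> r / \<phi> r\<close>. Monotonicity of \<open>\<psi> / \<phi>\<close> gives \<open>\<psi> \<le> c \<phi>\<close> on \<open>[\<alpha>, r)\<close> and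
  \<open>\<psi> \<ge> c \<phi>\<close> on \<open>[r, s)\<close>; integrating, passing from \<open>r\<close> to \<open>s\<close> can only raise the ratio of the
  integrals. The decreasing case follows on replacing \<open>\<psi>\<close> by \<open>-\<psi>\<close>.
\<close>

text \<open>Integrability passes to measurable subsets. The smaller set is measurable because both
  its endpoints lie in \<open>T\<close>, so that it is one of the half-open sets generating the
  Delta measure.\<close>

lemma delta_integrable_subinterval:
  assumes "time_scale T" "c \<in> T" "d \<in> T" "a \<le> c" "c \<le> d" "d \<le> b" "delta_integrable T a b f"
  shows "delta_integrable T c d f"
  using assms(7) unfolding delta_integrable_def
  by (rule set_integrable_subset) (use emeasure_delta_measure(1)[OF assms(1-3,5)] assms(4,6) in auto)

lemma delta_integral_combine:
  assumes T: "time_scale T" "a \<in> T" "b \<in> T" "c \<in> T" and le: "a \<le> b" "b \<le> c"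
    and f: "delta_integrable T a c f"
  shows "delta_integral T a c f = delta_integral T a b f + delta_integral T b c f"
proof -
  have "{a..<c} \<inter> T = ({a..<b} \<inter> T) \<union> ({b..<c} \<inter> T)" using le by auto
  moreover have "delta_integrable T a b f" "delta_integrable T b c f"
    using delta_integrable_subinterval[OF T(1) _ _ _ _ _ f] T le by auto
  moreover have "({a..<b} \<inter> T) \<inter> ({b..<c} \<inter> T) = {}" by auto
  ultimately show ?thesis
    unfolding delta_integral_def delta_integrable_def by (simp add: set_integral_Un)
qed

lemma delta_integral_mono:
  assumes "delta_integrable T a b f" "delta_integrable T a b g"
    and "\<And>t. t \<in> {a..<b} \<inter> T \<Longrightarrow> f t \<le> g t"
  shows "delta_integral T a b f \<le> delta_integral T a b g"
  using assms unfolding delta_integrable_def delta_integral_def by (rule set_integral_mono)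

text \<open>A nonnegative function with vanishing integral is zero almost everywhere. Here this
  would make \<open>{a..<b} \<inter> T\<close> a null set, yet its Delta measure is
  \<open>b - a > 0\<close>. Strict positivity makes the denominators of the integral ratio
  nonzero.\<close>

lemma delta_integral_pos:
  assumes T: "time_scale T" "a \<in> T" "b \<in> T" and "a < b"
    and f: "delta_integrable T a b f" and pos: "\<And>t. t \<in> {a..<b} \<inter> T \<Longrightarrow> f t > 0"
  shows "delta_integral T a b f > 0"
proof -
  let ?M = "delta_measure T" and ?A = "{a..<b} \<inter> T"
  let ?g = "\<lambda>x. indicator ?A x *\<^sub>R f x"
  have g: "integrable ?M ?g" "\<And>x. ?g x \<ge> 0"
    using f pos by (auto simp: delta_integrable_def set_integrable_def indicator_def less_imp_le)
  have A: "?A \<in> sets ?M" "emeasure ?M ?A > 0"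
    using emeasure_delta_measure[OF T] \<open>a < b\<close> by auto
  have "integral\<^sup>L ?M ?g \<noteq> 0"
  proof
    assume "integral\<^sup>L ?M ?g = 0"
    then have "AE x in ?M. ?g x = 0"
      using integral_nonneg_eq_0_iff_AE[OF g(1)] g(2) by simp
    then have "AE x in ?M. x \<notin> ?A"
      by (rule eventually_mono) (use pos in force)
    then have "emeasure ?M ?A = 0"
      using AE_iff_measurable[OF A(1), of "\<lambda>x. x \<notin> ?A"] sets.sets_into_space[OF A(1)] by blast
    then show False using A(2) by simp
  qed
  moreover have "integral\<^sup>L ?M ?g \<ge> 0" using g(2) by simp
  ultimately show ?thesis unfolding delta_integral_def set_lebesgue_integral_def by linarith
qed

text \<open>The increasing case, with no sign condition on \<psi>, so that it also applies to the
  negative of \<psi>.\<close>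

lemma mono_on_delta_integral_ratio:
  assumes T: "time_scale T" "\<alpha> \<in> T" "\<beta> \<in> T"
    and \<psi>: "delta_integrable T \<alpha> \<beta> \<psi>" and \<phi>: "delta_integrable T \<alpha> \<beta> \<phi>"
    and pos: "\<And>t. t \<in> {\<alpha>..\<beta>} \<inter> T \<Longrightarrow> \<phi> t > 0"
    and mono: "mono_on ({\<alpha>..\<beta>} \<inter> T) (\<lambda>t. \<psi> t / \<phi> t)"
  shows "mono_on ({\<alpha><..\<beta>} \<inter> T) (\<lambda>s. delta_integral T \<alpha> s \<psi> / delta_integral T \<alpha> s \<phi>)"
proof (rule mono_onI)
  fix r s assume "r \<in> {\<alpha><..\<beta>} \<inter> T" "s \<in> {\<alpha><..\<beta>} \<inter> T" and rs: "r \<le> s"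
  then have r: "\<alpha> < r" "r \<le> \<beta>" "r \<in> T" and s: "\<alpha> < s" "s \<le> \<beta>" "s \<in> T" by auto
  \<comment> \<open>If \<open>r\<close> is \<beta>, this is the ratio at a point outside every range
    of integration involved, which is why monotonicity is used up to and including \<beta>.\<close>
  define c where "c = \<psi> r / \<phi> r"
  note sub = delta_integrable_subinterval[OF T(1)]
  have int: "delta_integrable T \<alpha> r f" "delta_integrable T r s f" "delta_integrable T \<alpha> s f"
    if "delta_integrable T \<alpha> \<beta> f" for f
    using sub[OF _ _ _ _ _ that] T r s rs by auto
  have c\<phi>: "delta_integrable T \<alpha> \<beta> (\<lambda>t. c * \<phi> t)"
    using \<phi> unfolding delta_integrable_def by simp
  \<comment> \<open>This holds for all \<open>a\<close> and \<open>b\<close>: the Bochner integral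
    of a non-integrable function is 0 by convention, which is compatible with scaling.\<close>
  have scale: "delta_integral T a b (\<lambda>t. c * \<phi> t) = c * delta_integral T a b \<phi>" for a b
    by (simp add: delta_integral_def)
  have "\<psi> t \<le> c * \<phi> t" if "t \<in> {\<alpha>..<r} \<inter> T" for t
    using mono_onD[OF mono, of t r] that r pos[of t] by (simp add: c_def field_simps)
  from delta_integral_mono[OF int(1)[OF \<psi>] int(1)[OF c\<phi>] this]
  have left: "delta_integral T \<alpha> r \<psi> \<le> c * delta_integral T \<alpha> r \<phi>" by (simp add: scale)
  have "c * \<phi> t \<le> \<psi> t" if "t \<in> {r..<s} \<inter> T" for t
    using mono_onD[OF mono, of r t] that r s pos[of t] by (simp add: c_def field_simps)
  from delta_integral_mono[OF int(2)[OF c\<phi>] int(2)[OF \<psi>] this]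
  have right: "c * delta_integral T r s \<phi> \<le> delta_integral T r s \<psi>" by (simp add: scale)
  have \<Phi>r: "delta_integral T \<alpha> r \<phi> > 0" and \<Phi>s: "delta_integral T \<alpha> s \<phi> > 0"
    using delta_integral_pos[OF T(1,2)] int[OF \<phi>] pos r s by auto
  \<comment> \<open>Only a weak inequality is available, since \<open>r = s\<close> is allowed and
    the range of integration is then empty.\<close>
  have \<Phi>rs: "delta_integral T r s \<phi> \<ge> 0"
    unfolding delta_integral_def set_lebesgue_integral_def
    using pos r s by (intro Bochner_Integration.integral_nonneg) (auto simp: indicator_def less_imp_le)
  have split: "delta_integral T \<alpha> s f = delta_integral T \<alpha> r f + delta_integral T r s f"
    if "delta_integrable T \<alpha> \<beta> f" for f
    using delta_integral_combine[OF T(1,2) r(3) s(3) _ rs int(3)[OF that]] r by simp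
  \<comment> \<open>Write \<open>P\<close>, \<open>F\<close> for the integrals of \<psi>, \<phi>
    from \<alpha> to \<open>r\<close> and \<open>p\<close>, \<open>f\<close> for those from
    \<open>r\<close> to \<open>s\<close>. After cross-multiplication and cancelling
    \<open>P * F\<close>, the goal \<open>P / F \<le> (P + p) / (F + f)\<close> becomes
    \<open>P * f \<le> p * F\<close>; the middle term \<open>c * F * f\<close> links the two
    sides.\<close>
  have "delta_integral T \<alpha> r \<psi> * delta_integral T r s \<phi>
      \<le> c * delta_integral T \<alpha> r \<phi> * delta_integral T r s \<phi>"
    using left \<Phi>rs by (rule mult_right_mono)
  also have "\<dots> \<le> delta_integral T r s \<psi> * delta_integral T \<alpha> r \<phi>"
    using mult_right_mono[OF right less_imp_le[OF \<Phi>r]] by (simp add: ac_simps)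
  finally show "delta_integral T \<alpha> r \<psi> / delta_integral T \<alpha> r \<phi>
      \<le> delta_integral T \<alpha> s \<psi> / delta_integral T \<alpha> s \<phi>"
    using \<Phi>r \<Phi>s unfolding split[OF \<psi>] split[OF \<phi>] by (simp add: frac_le_eq field_simps)
qed

theorem theorem2p1:
  fixes T :: "real set" and \<alpha> \<beta> :: real and \<psi> \<phi> :: "real \<Rightarrow> real"
  assumes "time_scale T"
    and "\<alpha> \<in> T" and "\<beta> \<in> T" and "\<alpha> < \<beta>"
    and "delta_integrable T \<alpha> \<beta> \<psi>" and "delta_integrable T \<alpha> \<beta> \<phi>"
    and "\<And>t. t \<in> {\<alpha>..\<beta>} \<inter> T \<Longrightarrow> \<phi> t > 0"
  shows "(mono_on ({\<alpha>..\<beta>} \<inter> T) (\<lambda>t. \<psi> t / \<phi> t) \<longrightarrow>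
            mono_on ({\<alpha><..\<beta>} \<inter> T) (\<lambda>s. delta_integral T \<alpha> s \<psi> / delta_integral T \<alpha> s \<phi>)) \<and>
         (antimono_on ({\<alpha>..\<beta>} \<inter> T) (\<lambda>t. \<psi> t / \<phi> t) \<longrightarrow>
            antimono_on ({\<alpha><..\<beta>} \<inter> T) (\<lambda>s. delta_integral T \<alpha> s \<psi> / delta_integral T \<alpha> s \<phi>))"
proof (intro conjI impI)
  assume "mono_on ({\<alpha>..\<beta>} \<inter> T) (\<lambda>t. \<psi> t / \<phi> t)"
  then show "mono_on ({\<alpha><..\<beta>} \<inter> T) (\<lambda>s. delta_integral T \<alpha> s \<psi> / delta_integral T \<alpha> s \<phi>)"
    using assms by (intro mono_on_delta_integral_ratio)
next
  have neg: "delta_integrable T \<alpha> \<beta> (\<lambda>t. - \<psi> t)"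
    using assms(5) by (simp add: delta_integrable_def set_integrable_def)
  assume "antimono_on ({\<alpha>..\<beta>} \<inter> T) (\<lambda>t. \<psi> t / \<phi> t)"
  then have "mono_on ({\<alpha>..\<beta>} \<inter> T) (\<lambda>t. - \<psi> t / \<phi> t)"
    by (simp add: monotone_on_def)
  with neg assms
  have "mono_on ({\<alpha><..\<beta>} \<inter> T) (\<lambda>s. delta_integral T \<alpha> s (\<lambda>t. - \<psi> t) / delta_integral T \<alpha> s \<phi>)"
    by (intro mono_on_delta_integral_ratio)
  \<comment> \<open>The minus sign moves out of the integral and the quotient, and removing it
    reverses the inequality.\<close>
  then show "antimono_on ({\<alpha><..\<beta>} \<inter> T) (\<lambda>s. delta_integral T \<alpha> s \<psi> / delta_integral T \<alpha> s \<phi>)"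
    by (simp add: monotone_on_def delta_integral_def set_lebesgue_integral_def)
qed

end
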